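(* For $n\geq 0$, let $Q(\mathcal{PB}_n)$ be the set of projections of the partial Brauer monoid $\mathcal{PB}_n$ of rank at most $2$. Then $$|Q(\mathcal{PB}_n)|=\frac{I(n+2)}{2},$$ where $I(m)$ denotes the $m$th involution number.
   Context: For an integer $n\ge 0$ let $\mathbf n=\{1,\dots,n\}$ and $\mathbf n'=\{1',\dots,n'\}$. The partition monoid $\mathcal P_n$ is the set of all set partitions of $\mathbf n\cup\mathbf n'$. Product of $\alpha,\beta\in\mathcal P_n$: with $\mathbf n''=\{1'',\dots,n''\}$, rename each $x'$ in $\alpha$ as $x''$ and each (unprimed) $x$ in $\beta$ as $x''$; consider the equivalence on $\mathbf n\cup\mathbf n''\cup\mathbf n'$ generated by the blocks of these two renamed partitions; $x,y\in\mathbf n\cup\mathbf n'$ are in the same block of $\alpha\beta$ iff they are related by this equivalence. $\alpha^*$ is obtained from $\alpha$ by interchanging $x$ and $x'$ for all $x$. The rank of $\alpha$ is the number of its blocks meeting both $\mathbf n$ and $\mathbf n'$. A projection is an element $\varepsilon$ with $\varepsilon^2=\varepsilon=\varepsilon^*$. $\mathcal{PB}_n$ is the submonoid of $\mathcal P_n$ of all partitions all of whose blocks have size at most $2$. The involution number $I(m)$ is the number of self-inverse permutations of $\{1,\dots,m\}$ (including the identity), so $I(0)=I(1)=1$ and $I(m)=I(m-1)+(m-1)I(m-2)$ for $m\ge2$. *)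

theory Defs
  imports Complex_Main "HOL-Library.Disjoint_Sets" "HOL-Combinatorics.Permutations"
begin

text \<open>The points $x$, $x'$, $x''$. Partitions only involve the first two kinds; the third is used
  for the middle row in products.\<close>

datatype point = Unprimed nat | Primed nat | DPrimed nat

definition upper_row :: "nat \<Rightarrow> point set" where
  "upper_row n = Unprimed ` {1..n}"

definition lower_row :: "nat \<Rightarrow> point set" where
  "lower_row n = Primed ` {1..n}"

definition partition_monoid :: "nat \<Rightarrow> point set set set" where
  "partition_monoid n = {\<alpha>. partition_on (upper_row n \<union> lower_row n) \<alpha>}"

fun primed_to_dprimed :: "point \<Rightarrow> point" where
  "primed_to_dprimed (Primed x) = DPrimed x"
| "primed_to_dprimed p = p"

fun unprimed_to_dprimed :: "point \<Rightarrow> point" where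
  "unprimed_to_dprimed (Unprimed x) = DPrimed x"
| "unprimed_to_dprimed p = p"

fun swap_rows :: "point \<Rightarrow> point" where
  "swap_rows (Unprimed x) = Primed x"
| "swap_rows (Primed x) = Unprimed x"
| "swap_rows (DPrimed x) = DPrimed x"

definition rename :: "(point \<Rightarrow> point) \<Rightarrow> point set set \<Rightarrow> point set set" where
  "rename f \<alpha> = (\<lambda>B. f ` B) ` \<alpha>"

text \<open>The equivalence generated by the blocks of the two renamed partitions. It is an equivalence
  on the whole type, but relates points outside the three rows only to themselves.\<close>

definition product_equiv :: "point set set \<Rightarrow> point set set \<Rightarrow> point \<Rightarrow> point \<Rightarrow> bool" where
  "product_equiv \<alpha> \<beta> = equivclp (\<lambda>x y.
     \<exists>B \<in> rename primed_to_dprimed \<alpha> \<union> rename unprimed_to_dprimed \<beta>. x \<in> B \<and> y \<in> B)"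

definition pmult :: "nat \<Rightarrow> point set set \<Rightarrow> point set set \<Rightarrow> point set set" where
  "pmult n \<alpha> \<beta> = (let V = upper_row n \<union> lower_row n in
     V // {(x, y). x \<in> V \<and> y \<in> V \<and> product_equiv \<alpha> \<beta> x y})"

definition pstar :: "point set set \<Rightarrow> point set set" where
  "pstar \<alpha> = rename swap_rows \<alpha>"

definition prank :: "nat \<Rightarrow> point set set \<Rightarrow> nat" where
  "prank n \<alpha> = card {B \<in> \<alpha>. B \<inter> upper_row n \<noteq> {} \<and> B \<inter> lower_row n \<noteq> {}}"

definition partial_brauer_monoid :: "nat \<Rightarrow> point set set set" where
  "partial_brauer_monoid n = {\<alpha> \<in> partition_monoid n. \<forall>B\<in>\<alpha>. card B \<le> 2}"

definition projections :: "nat \<Rightarrow> point set set set \<Rightarrow> point set set set" where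
  "projections n S = {\<epsilon> \<in> S. pmult n \<epsilon> \<epsilon> = \<epsilon> \<and> \<epsilon> = pstar \<epsilon>}"

definition Q_PB :: "nat \<Rightarrow> point set set set" where
  "Q_PB n = {\<epsilon> \<in> projections n (partial_brauer_monoid n). prank n \<epsilon> \<le> 2}"

definition involution_number :: "nat \<Rightarrow> nat" where
  "involution_number m = card {\<pi> :: nat \<Rightarrow> nat. \<pi> permutes {1..m} \<and> inv \<pi> = \<pi>}"

end

theory Submission imports Defs begin

text \<open>A projection of the partial Brauer monoid is symmetric, and idempotency forces each transversal
  to be of the form \<open>{x, x'}\<close>. Hence a projection is an involution \<open>\<sigma>\<close> of \<open>{1..n}\<close> with
  a set \<open>T\<close> of marked fixed points (the transversals), of rank \<open>card T\<close>. An involution of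
  \<open>insert a S\<close> arises from one of \<open>S\<close> by either fixing \<open>a\<close> or pairing it with a fixed point. Adding
  two points, an involution with \<open>k\<close> fixed points therefore has \<open>k\<^sup>2 + k + 2\<close> extensions, twice the
  number of sets of at most two of its fixed points.\<close>

section \<open>Counting involutions\<close>

text \<open>Defined over an arbitrary set, so that points can be adjoined one at a time; for
  \<open>{1..m}\<close> it is the set that \<open>involution_number m\<close> counts.\<close>

definition involutions :: "'a set \<Rightarrow> ('a \<Rightarrow> 'a) set" where
  "involutions S = {\<sigma>. \<sigma> permutes S \<and> inv \<sigma> = \<sigma>}"

lemma involutions_iff:
  "\<sigma> \<in> involutions S \<longleftrightarrow> (\<forall>x. \<sigma> (\<sigma> x) = x) \<and> (\<forall>x. x \<notin> S \<longrightarrow> \<sigma> x = x)"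
proof
  assume "\<sigma> \<in> involutions S"
  then have p: "\<sigma> permutes S" and i: "inv \<sigma> = \<sigma>" by (auto simp: involutions_def)
  from permutes_inverses(1)[OF p] i permutes_not_in[OF p]
  show "(\<forall>x. \<sigma> (\<sigma> x) = x) \<and> (\<forall>x. x \<notin> S \<longrightarrow> \<sigma> x = x)" by simp
next
  assume *: "(\<forall>x. \<sigma> (\<sigma> x) = x) \<and> (\<forall>x. x \<notin> S \<longrightarrow> \<sigma> x = x)"
  then have "\<sigma> permutes S" unfolding permutes_def by metis
  moreover have "inv \<sigma> = \<sigma>" using * by (intro inv_unique_comp) auto
  ultimately show "\<sigma> \<in> involutions S" by (simp add: involutions_def)
qed

lemma involutions_apply_twice: "\<sigma> \<in> involutions S \<Longrightarrow> \<sigma> (\<sigma> x) = x"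
  by (simp add: involutions_iff)

lemma involutions_fix_outside: "\<sigma> \<in> involutions S \<Longrightarrow> x \<notin> S \<Longrightarrow> \<sigma> x = x"
  by (simp add: involutions_iff)

lemma involutions_in: "\<sigma> \<in> involutions S \<Longrightarrow> \<sigma> x \<in> S \<longleftrightarrow> x \<in> S"
  unfolding involutions_iff by metis

lemma finite_involutions: "finite S \<Longrightarrow> finite (involutions S)"
  unfolding involutions_def using finite_permutations[of S]
  by (rule rev_finite_subset) auto

definition fixed_points :: "'a set \<Rightarrow> ('a \<Rightarrow> 'a) \<Rightarrow> 'a set" where
  "fixed_points S \<sigma> = {x \<in> S. \<sigma> x = x}"

lemma finite_fixed_points: "finite S \<Longrightarrow> finite (fixed_points S \<sigma>)"
  by (simp add: fixed_points_def)

text \<open>The pair belonging to an involution \<tau> of the larger set consists of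
  \<open>t = \<tau> a\<close> and of what is left of \<tau> once the cycle through \<open>a\<close>
  is cancelled by composing with \<open>transpose a t\<close>. The choice \<open>t = a\<close> gives
  the trivial transposition and leaves \<open>a\<close> fixed.\<close>

lemma bij_betw_involutions_insert:
  assumes "a \<notin> S"
  shows "bij_betw (\<lambda>(\<sigma>, t). \<sigma> \<circ> transpose a t)
           (SIGMA \<sigma>:involutions S. insert a (fixed_points S \<sigma>)) (involutions (insert a S))"
proof (rule bij_betw_byWitness[where f' = "\<lambda>\<tau>. (\<tau> \<circ> transpose a (\<tau> a), \<tau> a)"])
  show "\<forall>p \<in> (SIGMA \<sigma>:involutions S. insert a (fixed_points S \<sigma>)).
      (\<lambda>\<tau>. (\<tau> \<circ> transpose a (\<tau> a), \<tau> a)) ((\<lambda>(\<sigma>, t). \<sigma> \<circ> transpose a t) p) = p"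
    using assms
    by (auto simp: fun_eq_iff transpose_def fixed_points_def involutions_iff)
  show "\<forall>\<tau> \<in> involutions (insert a S).
      (\<lambda>(\<sigma>, t). \<sigma> \<circ> transpose a t) ((\<lambda>\<tau>. (\<tau> \<circ> transpose a (\<tau> a), \<tau> a)) \<tau>) = \<tau>"
    by (auto simp: fun_eq_iff)
  show "(\<lambda>(\<sigma>, t). \<sigma> \<circ> transpose a t) ` (SIGMA \<sigma>:involutions S. insert a (fixed_points S \<sigma>))
      \<subseteq> involutions (insert a S)"
  proof clarsimp
    fix \<sigma> t assume s: "\<sigma> \<in> involutions S" and t: "t = a \<or> t \<in> fixed_points S \<sigma>"
    have i: "\<And>x. \<sigma> (\<sigma> x) = x" and o: "\<And>x. x \<notin> S \<Longrightarrow> \<sigma> x = x"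
      using s by (auto simp: involutions_iff)
    have "\<sigma> t = t" "t \<in> insert a S" using t o assms by (auto simp: fixed_points_def)
    moreover have "\<sigma> a = a" using o assms by simp
    \<comment> \<open>An involution can be moved across an equation. This settles the cases in which
      \<open>\<sigma> x\<close> is compared with \<open>a\<close> or \<open>t\<close>.\<close>
    moreover have "\<sigma> x = y \<longleftrightarrow> x = \<sigma> y" for x y using i by metis
    ultimately show "\<sigma> \<circ> transpose a t \<in> involutions (insert a S)"
      using i o by (auto simp: involutions_iff transpose_def)
  qed
  show "(\<lambda>\<tau>. (\<tau> \<circ> transpose a (\<tau> a), \<tau> a)) ` involutions (insert a S)
      \<subseteq> (SIGMA \<sigma>:involutions S. insert a (fixed_points S \<sigma>))"
  proof clarsimp
    fix \<tau> assume s: "\<tau> \<in> involutions (insert a S)"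
    have i: "\<And>x. \<tau> (\<tau> x) = x" and o: "\<And>x. x \<notin> S \<Longrightarrow> x \<noteq> a \<Longrightarrow> \<tau> x = x"
      using s by (auto simp: involutions_iff)
    have e: "\<tau> x = y \<longleftrightarrow> x = \<tau> y" for x y using i by metis
    \<comment> \<open>Otherwise \<open>\<tau> a\<close> would lie outside \<open>insert a S\<close>
      and be fixed by \<tau>, while \<tau> sends it back to \<open>a\<close>.\<close>
    have m: "\<tau> a = a \<or> \<tau> a \<in> S" using o i by metis
    show "\<tau> \<circ> transpose a (\<tau> a) \<in> involutions S \<and>
       (\<tau> a = a \<or> \<tau> a \<in> fixed_points S (\<tau> \<circ> transpose a (\<tau> a)))"
      using i o e m by (auto simp: involutions_iff transpose_def fixed_points_def)
  qed
qed

lemma fixed_points_comp_transpose: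
  assumes "a \<notin> S" "\<sigma> \<in> involutions S" "t \<in> fixed_points S \<sigma>"
  shows "fixed_points (insert a S) (\<sigma> \<circ> transpose a t) = fixed_points S \<sigma> - {t}"
  using assms by (auto simp: fixed_points_def involutions_iff transpose_def)

lemma fixed_points_insert:
  assumes "a \<notin> S" "\<sigma> \<in> involutions S"
  shows "fixed_points (insert a S) \<sigma> = insert a (fixed_points S \<sigma>)"
  using assms by (auto simp: fixed_points_def involutions_iff)

text \<open>An involution with \<open>k\<close> fixed points has one extension with
  \<open>k + 1\<close> of them (\<open>a\<close> stays fixed) and \<open>k\<close> extensions with
  \<open>k - 1\<close> (\<open>a\<close> is paired with one of them). The weight \<open>f\<close>
  makes the step iterable. Truncation of \<open>k - 1\<close> at \<open>k = 0\<close> is harmless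
  because of the factor \<open>k\<close>.\<close>

lemma sum_involutions_insert:
  fixes f :: "nat \<Rightarrow> nat"
  assumes "finite S" "a \<notin> S"
  shows "(\<Sum>\<tau>\<in>involutions (insert a S). f (card (fixed_points (insert a S) \<tau>))) =
    (\<Sum>\<sigma>\<in>involutions S. f (card (fixed_points S \<sigma>) + 1) +
        card (fixed_points S \<sigma>) * f (card (fixed_points S \<sigma>) - 1))"
proof -
  have "(\<Sum>\<tau>\<in>involutions (insert a S). f (card (fixed_points (insert a S) \<tau>))) =
    (\<Sum>(\<sigma>, t)\<in>(SIGMA \<sigma>:involutions S. insert a (fixed_points S \<sigma>)).
        f (card (fixed_points (insert a S) (\<sigma> \<circ> transpose a t))))"
    by (subst sum.reindex_bij_betw[OF bij_betw_involutions_insert[OF assms(2)], symmetric])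
       (simp add: case_prod_beta)
  also have "\<dots> = (\<Sum>\<sigma>\<in>involutions S. \<Sum>t\<in>insert a (fixed_points S \<sigma>).
        f (card (fixed_points (insert a S) (\<sigma> \<circ> transpose a t))))"
    using assms by (subst sum.Sigma) (auto simp: finite_involutions finite_fixed_points)
  also have "\<dots> = (\<Sum>\<sigma>\<in>involutions S. f (card (fixed_points S \<sigma>) + 1) +
        card (fixed_points S \<sigma>) * f (card (fixed_points S \<sigma>) - 1))"
  proof (rule sum.cong[OF refl])
    fix \<sigma> assume s: "\<sigma> \<in> involutions S"
    have a: "a \<notin> fixed_points S \<sigma>" using assms by (simp add: fixed_points_def)
    have "(\<Sum>t\<in>fixed_points S \<sigma>. f (card (fixed_points (insert a S) (\<sigma> \<circ> transpose a t)))) =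
        (\<Sum>t\<in>fixed_points S \<sigma>. f (card (fixed_points S \<sigma>) - 1))"
      using fixed_points_comp_transpose[OF assms(2) s]
      by (intro sum.cong) (auto simp: finite_fixed_points assms)
    then show "(\<Sum>t\<in>insert a (fixed_points S \<sigma>).
        f (card (fixed_points (insert a S) (\<sigma> \<circ> transpose a t)))) =
      f (card (fixed_points S \<sigma>) + 1) + card (fixed_points S \<sigma>) * f (card (fixed_points S \<sigma>) - 1)"
      using a assms s by (simp add: finite_fixed_points fixed_points_insert)
  qed
  finally show ?thesis .
qed

lemma card_involutions_insert2:
  assumes "finite S" "a \<notin> S" "b \<notin> insert a S"
  shows "card (involutions (insert b (insert a S))) =
    2 * (\<Sum>\<sigma>\<in>involutions S. 1 + card (fixed_points S \<sigma>) + (card (fixed_points S \<sigma>) choose 2))"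
proof -
  \<comment> \<open>Adjoining \<open>b\<close> with the constant weight 1 leaves the weight
    \<open>1 + k\<close> on involutions of \<open>insert a S\<close>; adjoining \<open>a\<close> is
    then applied to that weight.\<close>
  have "card (involutions (insert b (insert a S))) =
      (\<Sum>\<tau>\<in>involutions (insert a S). 1 + card (fixed_points (insert a S) \<tau>))"
    using sum_involutions_insert[of "insert a S" b "\<lambda>_. 1"] assms by simp
  also have "\<dots> = (\<Sum>\<sigma>\<in>involutions S. 1 + (card (fixed_points S \<sigma>) + 1) +
        card (fixed_points S \<sigma>) * (1 + (card (fixed_points S \<sigma>) - 1)))"
    using sum_involutions_insert[of S a "\<lambda>k. 1 + k"] assms by simp
  also have "\<dots> = (\<Sum>\<sigma>\<in>involutions S.
      2 * (1 + card (fixed_points S \<sigma>) + (card (fixed_points S \<sigma>) choose 2)))"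
  proof (rule sum.cong[OF refl])
    fix \<sigma>
    have "1 + (k + 1) + k * (1 + (k - 1)) = 2 * (1 + k + (k choose 2))" for k :: nat
    \<comment> \<open>Zero is split off because of the truncated \<open>k - 1\<close>. For the rest,
      evenness of \<open>k * (k - 1)\<close> makes the integer division in \<open>choose_two\<close>
      exact.\<close>
    proof (cases k)
      case (Suc m)
      have "even (k * (k - 1))" by (cases "even k") auto
      then have "2 * (k choose 2) = k * (k - 1)"
        by (simp add: choose_two)
      with Suc show ?thesis by simp
    qed simp
    then show "1 + (card (fixed_points S \<sigma>) + 1) +
        card (fixed_points S \<sigma>) * (1 + (card (fixed_points S \<sigma>) - 1)) =
      2 * (1 + card (fixed_points S \<sigma>) + (card (fixed_points S \<sigma>) choose 2))" .
  qed
  finally show ?thesis by (simp add: sum_distrib_left)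
qed

lemma card_subsets_le_2:
  assumes "finite A"
  shows "card {T. T \<subseteq> A \<and> card T \<le> 2} = 1 + card A + (card A choose 2)"
proof -
  have fin: "finite {T. T \<subseteq> A \<and> card T = k}" for k
    using assms by simp
  have "{T. T \<subseteq> A \<and> card T \<le> 2} = (\<Union>k\<in>{0,1,2}. {T. T \<subseteq> A \<and> card T = k})"
    by auto
  also have "card \<dots> = (\<Sum>k\<in>{0,1,2}. card {T. T \<subseteq> A \<and> card T = k})"
    using fin by (intro card_UN_disjoint) auto
  also have "\<dots> = 1 + card A + (card A choose 2)"
    using assms by (simp add: n_subsets)
  finally show ?thesis .
qed

section \<open>Partitions from marked involutions\<close>

definition points :: "nat \<Rightarrow> point set" where
  "points n = upper_row n \<union> lower_row n"

lemma in_points [simp]: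
  "Unprimed x \<in> points n \<longleftrightarrow> x \<in> {1..n}"
  "Primed x \<in> points n \<longleftrightarrow> x \<in> {1..n}"
  "DPrimed x \<notin> points n"
  by (auto simp: points_def upper_row_def lower_row_def)

text \<open>The value on the middle row makes \<open>block \<sigma> T\<close> constant on the classes of the product of
  the corresponding partition with itself.\<close>

fun block :: "(nat \<Rightarrow> nat) \<Rightarrow> nat set \<Rightarrow> point \<Rightarrow> point set" where
  "block \<sigma> T (Unprimed x) = (if x \<in> T then {Unprimed x, Primed x} else {Unprimed x, Unprimed (\<sigma> x)})"
| "block \<sigma> T (Primed x) = (if x \<in> T then {Unprimed x, Primed x} else {Primed x, Primed (\<sigma> x)})"
| "block \<sigma> T (DPrimed x) = (if x \<in> T then {Unprimed x, Primed x} else {DPrimed x, DPrimed (\<sigma> x)})"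

definition marked_partition :: "nat \<Rightarrow> (nat \<Rightarrow> nat) \<Rightarrow> nat set \<Rightarrow> point set set" where
  "marked_partition n \<sigma> T = block \<sigma> T ` points n"

locale marked_involution =
  fixes n :: nat and \<sigma> :: "nat \<Rightarrow> nat" and T :: "nat set"
  assumes invol: "\<sigma> \<in> involutions {1..n}" and fixed: "T \<subseteq> fixed_points {1..n} \<sigma>"
begin

lemma apply_twice [simp]: "\<sigma> (\<sigma> x) = x"
  using invol by (rule involutions_apply_twice)

lemma apply_in: "\<sigma> x \<in> {1..n} \<longleftrightarrow> x \<in> {1..n}"
  using invol by (rule involutions_in)

lemma apply_marked [simp]: "x \<in> T \<Longrightarrow> \<sigma> x = x"
  using fixed by (auto simp: fixed_points_def)

lemma apply_in_marked [simp]: "\<sigma> x \<in> T \<longleftrightarrow> x \<in> T"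
  using apply_marked apply_twice by metis

lemma marked_in: "x \<in> T \<Longrightarrow> x \<in> {1..n}"
  using fixed by (auto simp: fixed_points_def)

lemma block_cong: "p \<in> block \<sigma> T q \<Longrightarrow> block \<sigma> T p = block \<sigma> T q"
  by (cases q) (auto split: if_splits)

lemma self_in_block: "p \<in> points n \<Longrightarrow> p \<in> block \<sigma> T p"
  by (cases p) auto

lemma block_subset: "p \<in> points n \<Longrightarrow> block \<sigma> T p \<subseteq> points n"
  using apply_in marked_in by (cases p) auto

text \<open>Describes a block as a fibre of \<open>block \<sigma> T\<close>, the form in which it is
  compared with an equivalence class of the product.\<close>

lemma block_eq: "p \<in> points n \<Longrightarrow> block \<sigma> T p = {q \<in> points n. block \<sigma> T q = block \<sigma> T p}"
  using block_cong block_subset self_in_block by blast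

lemma partition_on_marked: "partition_on (points n) (marked_partition n \<sigma> T)"
proof (rule partition_onI)
  show "\<Union> (marked_partition n \<sigma> T) = points n"
    unfolding marked_partition_def using self_in_block block_subset by blast
  show "{} \<notin> marked_partition n \<sigma> T"
    using self_in_block unfolding marked_partition_def by blast
  show "disjnt p q" if "p \<in> marked_partition n \<sigma> T" "q \<in> marked_partition n \<sigma> T" "p \<noteq> q" for p q
    using that block_cong unfolding marked_partition_def disjnt_def by blast
qed

lemma card_block_le: "card (block \<sigma> T p) \<le> 2"
  by (cases p) (auto simp: card_insert_if)

text \<open>Swapping the rows commutes with taking blocks, since \<sigma> acts in the same way on
  both rows and the marked blocks are symmetric.\<close>

lemma pstar_marked: "pstar (marked_partition n \<sigma> T) = marked_partition n \<sigma> T"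
proof -
  have sb: "swap_rows ` block \<sigma> T p = block \<sigma> T (swap_rows p)" if "p \<in> points n" for p
    using that by (cases p) auto
  have inv: "swap_rows (swap_rows p) = p" for p by (cases p) auto
  have sp: "swap_rows p \<in> points n" if "p \<in> points n" for p
    using that by (cases p) auto
  have "swap_rows ` points n = points n"
    using inv sp by (metis image_eqI subsetI subset_antisym image_subsetI)
  moreover have "pstar (marked_partition n \<sigma> T) = block \<sigma> T ` swap_rows ` points n"
    using sb by (simp add: pstar_def rename_def marked_partition_def image_image)
  ultimately show ?thesis by (simp add: marked_partition_def)
qed

text \<open>In one direction, \<open>block \<sigma> T\<close> is an invariant of the generating
  relation, hence of the equivalence. In the other, a hook in the upper row is already present in
  the first factor, a hook in the lower row in the second factor, and a transversal is obtained by
  passing through the middle row.\<close>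

lemma product_equiv_marked:
  assumes "p \<in> points n" "q \<in> points n"
  shows "product_equiv (marked_partition n \<sigma> T) (marked_partition n \<sigma> T) p q
    \<longleftrightarrow> block \<sigma> T p = block \<sigma> T q" (is "?E p q \<longleftrightarrow> _")
proof
  define r where "r = (\<lambda>x y. \<exists>B \<in> rename primed_to_dprimed (marked_partition n \<sigma> T)
      \<union> rename unprimed_to_dprimed (marked_partition n \<sigma> T). x \<in> B \<and> y \<in> B)"
  have E: "?E = equivclp r"
    by (simp add: product_equiv_def r_def)
  have r: "block \<sigma> T x = block \<sigma> T y" if rxy: "r x y" for x y
  proof -
    have U: "block \<sigma> T u = block \<sigma> T v"
      if "u \<in> primed_to_dprimed ` block \<sigma> T p" "v \<in> primed_to_dprimed ` block \<sigma> T p"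
        "p \<in> points n" for u v p
      using that by (cases p) (auto split: if_splits)
    have L: "block \<sigma> T u = block \<sigma> T v"
      if "u \<in> unprimed_to_dprimed ` block \<sigma> T p" "v \<in> unprimed_to_dprimed ` block \<sigma> T p"
        "p \<in> points n" for u v p
      using that by (cases p) (auto split: if_splits)
    show ?thesis
      using rxy U L unfolding r_def rename_def marked_partition_def by blast
  qed
  show "block \<sigma> T p = block \<sigma> T q" if "?E p q"
    using that unfolding E by (induction rule: equivclp_induct) (use r in metis)+
  have U: "r (primed_to_dprimed u) (primed_to_dprimed v)"
    if "x \<in> points n" "u \<in> block \<sigma> T x" "v \<in> block \<sigma> T x" for x u v
    using that unfolding r_def rename_def marked_partition_def by blast
  have L: "r (unprimed_to_dprimed u) (unprimed_to_dprimed v)"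
    if "x \<in> points n" "u \<in> block \<sigma> T x" "v \<in> block \<sigma> T x" for x u v
    using that unfolding r_def rename_def marked_partition_def by blast
  \<comment> \<open>The path from \<open>x\<close> to \<open>x'\<close> runs through
    \<open>x''\<close>: its first edge comes from the upper copy of the block, its second from the
    lower copy.\<close>
  have UL: "equivclp r (Unprimed x) (Primed x)" if "x \<in> T" for x
  proof -
    have "r (Unprimed x) (DPrimed x)" "r (DPrimed x) (Primed x)"
      using U[of "Unprimed x" "Unprimed x" "Primed x"] L[of "Unprimed x" "Unprimed x" "Primed x"]
        that marked_in[OF that] by auto
    then show ?thesis by (meson converse_r_into_equivclp equivclp_trans r_into_equivclp)
  qed
  show "?E p q" if "block \<sigma> T p = block \<sigma> T q"
  proof -
    have q: "q \<in> block \<sigma> T p" using that assms self_in_block by auto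
    show ?thesis
    proof (cases p)
      case (Unprimed x)
      show ?thesis
      proof (cases "x \<in> T")
        case True
        then show ?thesis using q Unprimed UL unfolding E by (auto intro: equivclp_refl)
      next
        case False
        then show ?thesis using q Unprimed U[OF assms(1), of p q] assms self_in_block
          unfolding E by (auto intro: r_into_equivclp)
      qed
    next
      case (Primed x)
      show ?thesis
      proof (cases "x \<in> T")
        case True
        then show ?thesis using q Primed UL equivclp_sym[OF UL] unfolding E by (auto intro: equivclp_refl)
      next
        case False
        then show ?thesis using q Primed L[OF assms(1), of p q] assms self_in_block
          unfolding E by (auto intro: r_into_equivclp)
      qed
    next
      case (DPrimed x)
      then show ?thesis using assms by simp
    qed
  qed
qed

lemma pmult_marked:
  "pmult n (marked_partition n \<sigma> T) (marked_partition n \<sigma> T) = marked_partition n \<sigma> T"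
proof -
  let ?R = "{(x, y). x \<in> points n \<and> y \<in> points n \<and>
      product_equiv (marked_partition n \<sigma> T) (marked_partition n \<sigma> T) x y}"
  have "?R `` {p} = block \<sigma> T p" if "p \<in> points n" for p
    using that product_equiv_marked block_eq[OF that] by auto
  then have "points n // ?R = block \<sigma> T ` points n"
    by (auto simp: quotient_def)
  then show ?thesis
    by (simp add: pmult_def Let_def points_def[symmetric] marked_partition_def)
qed

text \<open>Recovers \<open>T\<close> from the partition; this serves both the rank and
  injectivity.\<close>

lemma transversal_in_marked_iff: "{Unprimed x, Primed y} \<in> marked_partition n \<sigma> T \<longleftrightarrow> x \<in> T \<and> y = x"
proof
  assume "{Unprimed x, Primed y} \<in> marked_partition n \<sigma> T"
  then obtain p where "p \<in> points n" "{Unprimed x, Primed y} = block \<sigma> T p"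
    by (auto simp: marked_partition_def)
  then show "x \<in> T \<and> y = x"
    by (cases p) (auto split: if_splits simp: doubleton_eq_iff)
next
  assume "x \<in> T \<and> y = x"
  then show "{Unprimed x, Primed y} \<in> marked_partition n \<sigma> T"
    unfolding marked_partition_def using marked_in[of x]
    by (intro image_eqI[of _ _ "Unprimed x"]) auto
qed

text \<open>Recovers \<sigma> from the partition away from \<open>T\<close>. At a marked
  \<open>x\<close> the block is a transversal and carries no hook.\<close>

lemma hook_in_marked_iff:
  assumes "x \<in> {1..n}" "x \<notin> T"
  shows "{Unprimed x, Unprimed y} \<in> marked_partition n \<sigma> T \<longleftrightarrow> y = \<sigma> x"
proof
  assume "{Unprimed x, Unprimed y} \<in> marked_partition n \<sigma> T"
  then obtain p where "p \<in> points n" "{Unprimed x, Unprimed y} = block \<sigma> T p"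
    by (auto simp: marked_partition_def)
  then show "y = \<sigma> x"
    by (cases p) (auto split: if_splits simp: doubleton_eq_iff)
next
  assume "y = \<sigma> x"
  then show "{Unprimed x, Unprimed y} \<in> marked_partition n \<sigma> T"
    unfolding marked_partition_def using assms
    by (intro image_eqI[of _ _ "Unprimed x"]) auto
qed

lemma prank_marked: "prank n (marked_partition n \<sigma> T) = card T"
proof -
  have "{B \<in> marked_partition n \<sigma> T. B \<inter> upper_row n \<noteq> {} \<and> B \<inter> lower_row n \<noteq> {}}
      = (\<lambda>x. {Unprimed x, Primed x}) ` T" (is "?L = ?R")
  proof
    show "?L \<subseteq> ?R"
    proof
      fix B assume B: "B \<in> ?L"
      then obtain p where "p \<in> points n" "B = block \<sigma> T p" by (auto simp: marked_partition_def)
      then show "B \<in> ?R" using B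
        by (cases p) (auto simp: upper_row_def lower_row_def split: if_splits)
    qed
    show "?R \<subseteq> ?L"
      using marked_in transversal_in_marked_iff by (auto simp: upper_row_def lower_row_def)
  qed
  then show ?thesis
    by (simp add: prank_def card_image inj_on_def doubleton_eq_iff)
qed

end

section \<open>General facts on set partitions\<close>

lemma partition_on_in: "partition_on V P \<Longrightarrow> B \<in> P \<Longrightarrow> x \<in> B \<Longrightarrow> x \<in> V"
  using partition_onD1 by blast

lemma partition_on_block_eq:
  "partition_on V P \<Longrightarrow> B \<in> P \<Longrightarrow> C \<in> P \<Longrightarrow> x \<in> B \<Longrightarrow> x \<in> C \<Longrightarrow> B = C"
  by (auto simp: partition_on_def disjoint_def)

text \<open>A block of \<open>Q\<close> contains a point, this point lies in a block of
  \<open>P\<close>, and the two are blocks of \<open>Q\<close> that meet. So an inclusion is enough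
  to identify two partitions of one set.\<close>

lemma partition_on_subset_eq:
  assumes P: "partition_on V P" and Q: "partition_on V Q" and sub: "P \<subseteq> Q"
  shows "P = Q"
proof
  show "Q \<subseteq> P"
  proof
    fix B assume B: "B \<in> Q"
    then obtain x where x: "x \<in> B" "x \<in> V"
      using partition_onD3[OF Q] partition_on_in[OF Q] by fastforce
    then obtain C where "C \<in> P" "x \<in> C" using P by (auto simp: partition_on_def)
    with partition_on_block_eq[OF Q B] sub x show "B \<in> P" by auto
  qed
qed (rule sub)

section \<open>Projections of the partial Brauer monoid\<close>

text \<open>By symmetry \<open>{y, x'}\<close> is a block too. In the product of \<epsilon> with
  itself \<open>x\<close> is joined to \<open>y''\<close> and \<open>y''\<close> to
  \<open>x'\<close>, so by idempotency \<open>x\<close> and \<open>x'\<close> share a block of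
  \<epsilon>. That block meets \<open>{x, y'}\<close> in \<open>x\<close> and therefore equals
  it.\<close>

lemma projection_transversal:
  assumes part: "partition_on (points n) \<epsilon>" and idem: "pmult n \<epsilon> \<epsilon> = \<epsilon>" and star: "\<epsilon> = pstar \<epsilon>"
    and B: "{Unprimed x, Primed y} \<in> \<epsilon>"
  shows "y = x"
proof -
  have V: "Unprimed x \<in> points n"
    by (rule partition_on_in[OF part B]) simp
  have "swap_rows ` {Unprimed x, Primed y} \<in> pstar \<epsilon>"
    using B unfolding pstar_def rename_def by (rule imageI)
  then have B': "{Unprimed y, Primed x} \<in> \<epsilon>" using star by (simp add: insert_commute)
  let ?r = "\<lambda>x y. \<exists>B \<in> rename primed_to_dprimed \<epsilon> \<union> rename unprimed_to_dprimed \<epsilon>. x \<in> B \<and> y \<in> B"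
  have "primed_to_dprimed ` {Unprimed x, Primed y} \<in> rename primed_to_dprimed \<epsilon>"
    using B unfolding rename_def by (rule imageI)
  then have 1: "?r (Unprimed x) (DPrimed y)" by (auto intro!: bexI[rotated])
  have "unprimed_to_dprimed ` {Unprimed y, Primed x} \<in> rename unprimed_to_dprimed \<epsilon>"
    using B' unfolding rename_def by (rule imageI)
  then have 2: "?r (DPrimed y) (Primed x)" by (auto intro!: bexI[rotated])
  have "product_equiv \<epsilon> \<epsilon> (Unprimed x) (Primed x)"
    unfolding product_equiv_def using r_into_equivclp[of ?r, OF 1] r_into_equivclp[of ?r, OF 2]
    by (rule equivclp_trans)
  moreover have "product_equiv \<epsilon> \<epsilon> (Unprimed x) (Unprimed x)"
    unfolding product_equiv_def by (rule equivclp_refl)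
  moreover define C where "C = {q \<in> points n. product_equiv \<epsilon> \<epsilon> (Unprimed x) q}"
  ultimately have C: "C \<in> pmult n \<epsilon> \<epsilon>" "Unprimed x \<in> C" "Primed x \<in> C"
    using V by (auto simp: pmult_def Let_def points_def[symmetric] quotient_def)
  then have "C = {Unprimed x, Primed y}"
    using partition_on_block_eq[OF part _ B] idem by auto
  with C show ?thesis by auto
qed

lemma projection_marked:
  assumes eps: "\<epsilon> \<in> projections n (partial_brauer_monoid n)"
  obtains \<sigma> T where "marked_involution n \<sigma> T" "\<epsilon> = marked_partition n \<sigma> T"
proof -
  have part: "partition_on (points n) \<epsilon>" and card2: "\<And>B. B \<in> \<epsilon> \<Longrightarrow> card B \<le> 2"
    and idem: "pmult n \<epsilon> \<epsilon> = \<epsilon>" and star: "\<epsilon> = pstar \<epsilon>"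
    using eps by (auto simp: projections_def partial_brauer_monoid_def partition_monoid_def points_def)
  note eq = partition_on_block_eq[OF part]
  define T where "T = {x. {Unprimed x, Primed x} \<in> \<epsilon>}"
  have T_in: "T \<subseteq> {1..n}"
  proof
    fix x assume "x \<in> T"
    then have "Unprimed x \<in> points n"
      unfolding T_def by (intro partition_on_in[OF part, of "{Unprimed x, Primed x}"]) auto
    then show "x \<in> {1..n}" by simp
  qed
  have "\<exists>y. {Unprimed x, Unprimed y} \<in> \<epsilon>" if x: "x \<in> {1..n}" "x \<notin> T" for x
  proof -
    have "Unprimed x \<in> \<Union> \<epsilon>" using x partition_onD1[OF part] by auto
    then obtain B where B: "B \<in> \<epsilon>" "Unprimed x \<in> B" by blast
    have fin: "finite B"
    proof (rule finite_subset)
      show "B \<subseteq> points n" using part B by (auto simp: partition_on_def)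
      show "finite (points n)" by (simp add: points_def upper_row_def lower_row_def)
    qed
    have "card (B - {Unprimed x}) \<le> 1" using card2[OF B(1)] B(2) fin by simp
    then have "B - {Unprimed x} = {} \<or> (\<exists>q. B - {Unprimed x} = {q})"
      using fin by (metis card_0_eq card_1_singletonE finite_Diff le_Suc_eq One_nat_def le_zero_eq)
    \<comment> \<open>Here \<open>q = Unprimed x\<close> is allowed: a singleton block is read as a
      hook from \<open>x\<close> to itself and makes \<open>x\<close> an unmarked fixed
      point.\<close>
    then obtain q where q: "B = {Unprimed x, q}" using B(2) by blast
    have qV: "q \<in> points n" using part B q by (auto simp: partition_on_def)
    show ?thesis
    proof (cases q)
      case (Unprimed y)
      then show ?thesis using B q by auto
    next
      case (Primed y)
      then have "y = x" using projection_transversal[OF part idem star] B q by auto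
      then show ?thesis using x B q Primed by (auto simp: T_def)
    next
      case (DPrimed y)
      then show ?thesis using qV by simp
    qed
  qed
  then obtain f where f: "\<And>x. x \<in> {1..n} \<Longrightarrow> x \<notin> T \<Longrightarrow> {Unprimed x, Unprimed (f x)} \<in> \<epsilon>"
    by metis
  \<comment> \<open>The unmarked points are closed under \<open>f\<close>, so \<open>f\<close> can
    be applied again. A marked \<open>f x\<close> would lie both in a transversal and in a
    hook.\<close>
  have f_in: "f x \<in> {1..n}" and f_T: "f x \<notin> T" if "x \<in> {1..n}" "x \<notin> T" for x
  proof -
    have "Unprimed (f x) \<in> points n" by (rule partition_on_in[OF part f[OF that]]) simp
    then show "f x \<in> {1..n}" by simp
    show "f x \<notin> T"
    proof
      assume "f x \<in> T"
      then have "{Unprimed (f x), Primed (f x)} = {Unprimed x, Unprimed (f x)}"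
        using eq[OF _ f[OF that], of _ "Unprimed (f x)"] by (simp add: T_def)
      then show False by auto
    qed
  qed
  have ff: "f (f x) = x" if "x \<in> {1..n}" "x \<notin> T" for x
  proof -
    have "{Unprimed (f x), Unprimed (f (f x))} = {Unprimed x, Unprimed (f x)}"
      using eq[OF f[OF f_in[OF that] f_T[OF that]] f[OF that], of "Unprimed (f x)"] by simp
    then show ?thesis by (auto simp: doubleton_eq_iff)
  qed
  \<comment> \<open>The identity on \<open>T\<close> makes marked points fixed points; the identity
    outside \<open>{1..n}\<close> is required of a permutation of that set.\<close>
  define \<sigma> where "\<sigma> = (\<lambda>x. if x \<in> {1..n} - T then f x else x)"
  have "\<sigma> (\<sigma> x) = x" for x
    using f_in[of x] f_T[of x] ff[of x] by (cases "x \<in> {1..n} - T") (auto simp: \<sigma>_def)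
  then have "\<sigma> \<in> involutions {1..n}" by (auto simp: involutions_iff \<sigma>_def)
  moreover have "T \<subseteq> fixed_points {1..n} \<sigma>" using T_in by (auto simp: fixed_points_def \<sigma>_def)
  ultimately interpret marked_involution n \<sigma> T by unfold_locales
  \<comment> \<open>So far only upper hooks were used; those of the lower row are their mirror
    images.\<close>
  have low: "{Primed x, Primed (f x)} \<in> \<epsilon>" if "x \<in> {1..n}" "x \<notin> T" for x
  proof -
    have "swap_rows ` {Unprimed x, Unprimed (f x)} \<in> pstar \<epsilon>"
      using f[OF that] unfolding pstar_def rename_def by (rule imageI)
    then show ?thesis using star by simp
  qed
  have "block \<sigma> T p \<in> \<epsilon>" if "p \<in> points n" for p
    using that f low by (cases p) (auto simp: \<sigma>_def T_def)
  then have "marked_partition n \<sigma> T = \<epsilon>"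
    using partition_on_subset_eq[OF partition_on_marked part] by (auto simp: marked_partition_def)
  then show ?thesis using that[OF marked_involution_axioms] by simp
qed

section \<open>The parametrization of \<open>Q_PB n\<close> and the final count\<close>

lemma bij_betw_marked_partition:
  "bij_betw (\<lambda>(\<sigma>, T). marked_partition n \<sigma> T)
     (SIGMA \<sigma>:involutions {1..n}. {T. T \<subseteq> fixed_points {1..n} \<sigma> \<and> card T \<le> 2}) (Q_PB n)"
  (is "bij_betw ?F ?A _")
proof (rule bij_betw_imageI)
  show "inj_on ?F ?A"
  proof (rule inj_onI, clarify)
    fix \<sigma> T \<sigma>' T'
    assume "\<sigma> \<in> involutions {1..n}" "T \<subseteq> fixed_points {1..n} \<sigma>"
      "\<sigma>' \<in> involutions {1..n}" "T' \<subseteq> fixed_points {1..n} \<sigma>'"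
      and eq: "marked_partition n \<sigma> T = marked_partition n \<sigma>' T'"
    then interpret a: marked_involution n \<sigma> T + b: marked_involution n \<sigma>' T'
      by unfold_locales
    have T: "T = T'"
      using a.transversal_in_marked_iff b.transversal_in_marked_iff eq by auto
    \<comment> \<open>Away from \<open>T\<close> the hooks determine the value; on \<open>T\<close>
      and outside \<open>{1..n}\<close> both maps are the identity.\<close>
    have "\<sigma> x = \<sigma>' x" for x
    proof (cases "x \<in> {1..n} - T")
      case True
      then show ?thesis using a.hook_in_marked_iff[of x] b.hook_in_marked_iff[of x] eq T by auto
    next
      case False
      then have "x \<in> T \<or> x \<notin> {1..n}" by blast
      then show ?thesis
        using T a.apply_marked b.apply_marked involutions_fix_outside[OF a.invol]
          involutions_fix_outside[OF b.invol] by metis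
    qed
    with T show "\<sigma> = \<sigma>' \<and> T = T'" by auto
  qed
  show "?F ` ?A = Q_PB n"
  proof
    show "?F ` ?A \<subseteq> Q_PB n"
    proof clarify
      fix \<sigma> T assume "\<sigma> \<in> involutions {1..n}" "T \<subseteq> fixed_points {1..n} \<sigma>" and T: "card T \<le> 2"
      then interpret marked_involution n \<sigma> T by unfold_locales
      have "\<forall>B\<in>marked_partition n \<sigma> T. card B \<le> 2"
        using card_block_le by (auto simp: marked_partition_def)
      then show "marked_partition n \<sigma> T \<in> Q_PB n"
        using partition_on_marked pmult_marked pstar_marked prank_marked T
        by (simp add: Q_PB_def projections_def partial_brauer_monoid_def partition_monoid_def points_def)
    qed
    show "Q_PB n \<subseteq> ?F ` ?A"
    proof
      fix \<epsilon> assume e: "\<epsilon> \<in> Q_PB n"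
      then have "\<epsilon> \<in> projections n (partial_brauer_monoid n)" "prank n \<epsilon> \<le> 2"
        by (auto simp: Q_PB_def)
      then obtain \<sigma> T where m: "marked_involution n \<sigma> T" and et: "\<epsilon> = marked_partition n \<sigma> T"
        using projection_marked by blast
      then interpret marked_involution n \<sigma> T by simp
      have "(\<sigma>, T) \<in> ?A" using invol fixed \<open>prank n \<epsilon> \<le> 2\<close> prank_marked et by simp
      then show "\<epsilon> \<in> ?F ` ?A" using et by (intro image_eqI[of _ _ "(\<sigma>, T)"]) auto
    qed
  qed
qed

theorem proposition7p5:
  fixes n :: nat
  shows "real (card (Q_PB n)) = real (involution_number (n + 2)) / 2"
proof -
  have "card (Q_PB n) = card (SIGMA \<sigma>:involutions {1..n}. {T. T \<subseteq> fixed_points {1..n} \<sigma> \<and> card T \<le> 2})"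
    using bij_betw_same_card[OF bij_betw_marked_partition] by simp
  also have "\<dots> = (\<Sum>\<sigma>\<in>involutions {1..n}. card {T. T \<subseteq> fixed_points {1..n} \<sigma> \<and> card T \<le> 2})"
    by (rule card_SigmaI) (auto simp: finite_involutions finite_fixed_points)
  also have "\<dots> = (\<Sum>\<sigma>\<in>involutions {1..n}.
      1 + card (fixed_points {1..n} \<sigma>) + (card (fixed_points {1..n} \<sigma>) choose 2))"
    by (intro sum.cong refl card_subsets_le_2 finite_fixed_points) simp
  \<comment> \<open>Each summand is half the number of extensions of its involution by the two new
    points \<open>n + 1\<close> and \<open>n + 2\<close>.\<close>
  finally have "2 * card (Q_PB n) = card (involutions (insert (n + 2) (insert (n + 1) {1..n})))"
    by (subst card_involutions_insert2) auto
  also have "insert (n + 2) (insert (n + 1) {1..n}) = {1..n + 2}" by auto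
  also have "card (involutions {1..n + 2}) = involution_number (n + 2)"
    by (simp add: involution_number_def involutions_def)
  finally show ?thesis by linarith
qed

end
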